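(* Suppose that every point of the equilibrium set $\mathcal{E}$ of $(\mathcal{DI})$ is Lyapunov stable and that the solution $x(\cdot)$ of $(\mathcal{DI})$ is bounded. In addition, suppose that for a given $x_0\in C$ the solution $x(\cdot)$ with $x(0)=x_0$ satisfies $\lim_{t\to+\infty}\mathbf{d}(x(t);\mathcal{E})=0$. Then $x(t)\to z$ as $t\to+\infty$ for some $z\in\mathcal{E}$.
   Context: Setting. $A:\mathbb{R}^n\rightrightarrows\mathbb{R}^n$ is a maximally monotone operator with $\operatorname{int}(\operatorname{dom}A)\ne\varnothing$, where $\operatorname{dom}A=\{x: A(x)\neq\varnothing\}$; $C:=\operatorname{cl}(\operatorname{dom}A)$ (a closed convex set); $f:C\to\mathbb{R}^n$ is locally Lipschitz. $\mathbf{d}(\cdot;S)$ is the Euclidean distance to $S$. Let $E\subseteq\operatorname{int}(\operatorname{dom}A)$ be the set of points of $\operatorname{int}(\operatorname{dom} A)$ at which $A$ is single-valued and $A_0(x):=\{v:\exists (x_k)\subset E,\ x_k\to x,\ A(x_k)\to v\}$. $\operatorname{clco}A_0(x)$ is the closed convex hull of $A_0(x)$, and $N_C(x)$ the normal cone of convex analysis. It is known that $A(x)=\operatorname{clco}A_0(x)+N_C(x)$ for all $x$. For $x_0\in C$, consider the problem $(\mathcal{DI})$: $\dot x(t)\in f(x(t))-A(x(t))=f(x(t))-\operatorname{clco}A_0(x(t))-N_C(x(t))$ for a.e. $t\in[0,+\infty)$, $x(0)=x_0$. Standing fact/assumption: for every $x_0\in C$ this problem has a unique (absolutely continuous) solution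 $x:[0,+\infty)\to\mathbb{R}^n$. Equilibrium set: $\mathcal{E}:=\{\bar x\in C: f(\bar x)\in\operatorname{clco}A_0(\bar x)+N_C(\bar x)\}$. A point $\bar x\in\mathcal{E}$ is Lyapunov stable if for every $\varepsilon>0$ there is $\delta>0$ such that for every $x_0\in C$ with $\|x_0-\bar x\|\le\delta$ the solution of $(\mathcal{DI})$ with $x(0)=x_0$ satisfies $\|x(t)-\bar x\|<\varepsilon$ for all $t\ge0$. *)

theory Defs
  imports "HOL-Analysis.Analysis"
begin

definition dom_op :: "(real^'n \<Rightarrow> (real^'n) set) \<Rightarrow> (real^'n) set" where
  "dom_op A = {x. A x \<noteq> {}}"

definition monotone_op :: "(real^'n \<Rightarrow> (real^'n) set) \<Rightarrow> bool" where
  "monotone_op A \<longleftrightarrow>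
     (\<forall>x y. \<forall>u\<in>A x. \<forall>v\<in>A y. (u - v) \<bullet> (x - y) \<ge> 0)"

definition maximal_monotone_op :: "(real^'n \<Rightarrow> (real^'n) set) \<Rightarrow> bool" where
  "maximal_monotone_op A \<longleftrightarrow>
     monotone_op A \<and> (\<forall>B. monotone_op B \<and> (\<forall>x. A x \<subseteq> B x) \<longrightarrow> B = A)"

definition single_valued_pts :: "(real^'n \<Rightarrow> (real^'n) set) \<Rightarrow> (real^'n) set" where
  "single_valued_pts A = {x \<in> interior (dom_op A). is_singleton (A x)}"

definition A0 :: "(real^'n \<Rightarrow> (real^'n) set) \<Rightarrow> real^'n \<Rightarrow> (real^'n) set" where
  "A0 A x = {v. \<exists>xs w. (\<forall>k::nat. xs k \<in> single_valued_pts A \<and> A (xs k) = {w k}) \<and>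
                   xs \<longlonglongrightarrow> x \<and> w \<longlonglongrightarrow> v}"

definition clco :: "(real^'n) set \<Rightarrow> (real^'n) set" where
  "clco S = closure (convex hull S)"

definition normal_cone :: "(real^'n) set \<Rightarrow> real^'n \<Rightarrow> (real^'n) set" where
  "normal_cone C x = (if x \<in> C then {v. \<forall>y\<in>C. v \<bullet> (y - x) \<le> 0} else {})"

definition locally_lipschitz_on :: "(real^'n) set \<Rightarrow> (real^'n \<Rightarrow> real^'n) \<Rightarrow> bool" where
  "locally_lipschitz_on C f \<longleftrightarrow>
     (\<forall>x\<in>C. \<exists>r>0. \<exists>L. L-lipschitz_on (ball x r \<inter> C) f)"

definition absolutely_continuous_on :: "real \<Rightarrow> real \<Rightarrow> (real \<Rightarrow> real^'n) \<Rightarrow> bool" where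
  "absolutely_continuous_on a b x \<longleftrightarrow>
     (\<forall>\<epsilon>>0. \<exists>\<delta>>0. \<forall>(m::nat) u v.
        (\<forall>i<m. a \<le> u i \<and> u i \<le> v i \<and> v i \<le> b) \<and>
        (\<forall>i<m. \<forall>j<m. i \<noteq> j \<longrightarrow> {u i<..<v i} \<inter> {u j<..<v j} = {}) \<and>
        (\<Sum>i<m. v i - u i) < \<delta>
        \<longrightarrow> (\<Sum>i<m. norm (x (v i) - x (u i))) < \<epsilon>)"

text \<open>A trajectory on the half-line is a function on \<^typ>\<open>real\<close> whose values at negative
  times are irrelevant; absolute continuity on the half-line is understood, as usual for
  differential inclusions, on every compact interval. The velocity condition forces
  \<open>x t \<in> dom_op A\<close> for almost every t, so only values of f on the closure of the domain matter.\<close>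

definition solves_DI ::
  "(real^'n \<Rightarrow> (real^'n) set) \<Rightarrow> (real^'n \<Rightarrow> real^'n) \<Rightarrow> real^'n \<Rightarrow> (real \<Rightarrow> real^'n) \<Rightarrow> bool"
where
  "solves_DI A f x0 x \<longleftrightarrow>
     x 0 = x0 \<and>
     (\<forall>T\<ge>0. absolutely_continuous_on 0 T x) \<and>
     (AE t in lebesgue. t \<ge> 0 \<longrightarrow>
        (\<exists>a\<in>A (x t). (x has_vector_derivative (f (x t) - a)) (at t within {0..})))"

definition equilibria :: "(real^'n \<Rightarrow> (real^'n) set) \<Rightarrow> (real^'n \<Rightarrow> real^'n) \<Rightarrow> (real^'n) set"
where
  "equilibria A f =
     (let C = closure (dom_op A) in {x \<in> C. f x \<in> clco (A0 A x) + normal_cone C x})"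

definition lyapunov_stable ::
  "(real^'n \<Rightarrow> (real^'n) set) \<Rightarrow> (real^'n \<Rightarrow> real^'n) \<Rightarrow> real^'n \<Rightarrow> bool"
where
  "lyapunov_stable A f xbar \<longleftrightarrow>
     (\<forall>\<epsilon>>0. \<exists>\<delta>>0. \<forall>x0 \<in> closure (dom_op A). norm (x0 - xbar) \<le> \<delta> \<longrightarrow>
        (\<forall>x. solves_DI A f x0 x \<longrightarrow> (\<forall>t\<ge>0. norm (x t - xbar) < \<epsilon>)))"

text \<open>The distance is extended-valued, so that the distance to the empty set is \<open>\<infinity>\<close>;
  the library's \<^const>\<open>infdist\<close> would give 0 there.\<close>

definition dist_set :: "real^'n \<Rightarrow> (real^'n) set \<Rightarrow> ereal" where
  "dist_set x S = (INF y\<in>S. ereal (dist x y))"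

lemma dist_set_empty: "dist_set x {} = \<infinity>"
  by (simp add: dist_set_def top_ereal_def)

lemma dist_set_nonempty: "S \<noteq> {} \<Longrightarrow> dist_set x S = ereal (infdist x S)"
  by (simp add: dist_set_def infdist_notempty ereal_Inf' image_image)

end

theory Submission
  imports Defs
begin

text \<open>
  Why the trajectory converges. A bounded trajectory has a cluster point \<open>z\<close> as \<open>t \<rightarrow> \<infinity>\<close>, and since its
  distance to the equilibria tends to 0, \<open>z\<close> lies in the closure of the equilibrium set. If \<open>z\<close> is itself an
  equilibrium, it is Lyapunov stable; the trajectory comes arbitrarily close to \<open>z\<close> at some late time,
  and restarting it there (\<open>solves_DI_shift\<close>, \<open>solution_in_closure_dom\<close>) shows that it never leaves a given
  neighbourhood of \<open>z\<close> afterwards. So everything rests on the equilibrium set being closed.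

  Closedness (\<open>closed_equilibria\<close>) would be immediate if equilibria were the points \<open>x\<close> with
  \<open>f x \<in> A x\<close>, since a maximal monotone operator has a closed graph. They are defined through
  \<open>clco (A0 A x) + normal_cone C x\<close> instead, so the representation of \<open>A x\<close> as this sum has to be
  proved (\<open>maximal_monotone_representation\<close>). One inclusion is maximality. The other is a separation argument:
  a point of \<open>A x\<close> outside the sum would be strictly extreme in a direction tangent to the domain, and this is
  contradicted by following \<open>A\<close> towards \<open>x\<close> from inside the domain along nearly that direction
  (\<open>A0_directional_lower_bound\<close>).

  Following \<open>A\<close> in this way takes three facts about monotone operators. Values of \<open>A\<close> obey a coercivity
  estimate around each interior point of the domain (\<open>monotone_coercive_bound\<close>), which makes the relevant
  sequences bounded. Single-valued points are dense in the interior (\<open>single_valued_dense\<close>), so the path can be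
  chosen through them. And the interior of the domain of a maximal monotone operator is that of its convex hull
  (\<open>interior_convex_hull_dom_subset\<close>), so that segments from the closure into the interior are
  available.
\<close>

section \<open>Maximality, local boundedness and single-valued points\<close>

text \<open>
  Maximality is used only in this pointwise form: a vector that is monotonically related to the
  whole graph already belongs to the graph, because adjoining it keeps the operator monotone.
\<close>

lemma maximal_monotone_mem_iff:
  assumes "maximal_monotone_op A"
  shows "v \<in> A x \<longleftrightarrow> (\<forall>y. \<forall>u\<in>A y. (v - u) \<bullet> (x - y) \<ge> 0)"
proof
  have mono: "monotone_op A" using assms by (simp add: maximal_monotone_op_def)
  show "v \<in> A x \<Longrightarrow> \<forall>y. \<forall>u\<in>A y. (v - u) \<bullet> (x - y) \<ge> 0"
    using mono by (auto simp: monotone_op_def)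
  assume related: "\<forall>y. \<forall>u\<in>A y. (v - u) \<bullet> (x - y) \<ge> 0"
  define B where "B = A(x := insert v (A x))"
  have swap: "(u - v) \<bullet> (y - x) = (v - u) \<bullet> (x - y)" for u y
    by (simp add: inner_diff_left inner_diff_right)
  have "monotone_op B"
    using mono related unfolding monotone_op_def B_def
    by (auto simp: swap)
  moreover have "\<forall>y. A y \<subseteq> B y" by (auto simp: B_def)
  ultimately have "B = A" using assms by (simp add: maximal_monotone_op_def)
  then show "v \<in> A x" by (metis B_def fun_upd_same insertI1)
qed

text \<open>
  This estimate is the source of every boundedness argument below. Test \<open>w \<in> A z\<close> by monotonicity
  against fixed values of \<open>A\<close> at the finitely many points \<open>P \<plusminus> \<rho> e\<close>, with \<open>e\<close> in the standard
  basis: each test bounds one signed coordinate of \<open>w\<close>. The point \<open>z\<close> is arbitrary; near \<open>P\<close> the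
  term \<open>w \<bullet> (z - P)\<close> can be absorbed on the left, and far from \<open>P\<close> it suffices to bound it from
  above by other means.
\<close>

lemma monotone_coercive_bound:
  fixes A :: "real^'n \<Rightarrow> (real^'n) set"
  assumes mono: "monotone_op A" and P: "P \<in> interior (dom_op A)"
  obtains r K where "r > 0" "K \<ge> 0"
    "\<And>z w. w \<in> A z \<Longrightarrow> r * norm w \<le> w \<bullet> (z - P) + K * (1 + norm (z - P))"
proof -
  obtain \<rho> where \<rho>: "\<rho> > 0" "cball P \<rho> \<subseteq> dom_op A"
    using P mem_interior_cball by blast
  define V where "V = (\<lambda>b. P + \<rho> *\<^sub>R b) ` (Basis \<union> uminus ` Basis)"
  have "V \<subseteq> cball P \<rho>" using \<rho>(1) by (auto simp: V_def dist_norm)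
  then have "\<forall>y\<in>V. \<exists>v. v \<in> A y" using \<rho>(2) by (auto simp: dom_op_def)
  then obtain a where a: "\<And>y. y \<in> V \<Longrightarrow> a y \<in> A y" by metis
  define K where "K = (\<Sum>y\<in>V. norm (a y)) * (1 + \<rho>)"
  define n where "n = real DIM(real^'n)"
  have n: "n > 0" by (simp add: n_def)
  have finV: "finite V" by (simp add: V_def)
  have S0: "(\<Sum>y\<in>V. norm (a y)) \<ge> 0" by (simp add: sum_nonneg)
  have K0: "K \<ge> 0" using S0 \<rho>(1) by (simp add: K_def)
  have dir: "\<rho> * (w \<bullet> b) \<le> w \<bullet> (z - P) + K * (1 + norm (z - P))"
    if w: "w \<in> A z" and b: "b \<in> Basis \<union> uminus ` Basis" for w z b
  proof -
    let ?y = "P + \<rho> *\<^sub>R b"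
    have y: "?y \<in> V" using b by (auto simp: V_def)
    have nb: "norm b = 1" using b by auto
    have "(w - a ?y) \<bullet> (z - ?y) \<ge> 0" using mono a[OF y] w by (auto simp: monotone_op_def)
    then have "\<rho> * (w \<bullet> b) \<le> w \<bullet> (z - P) + a ?y \<bullet> (?y - z)"
      by (simp add: inner_diff_left inner_diff_right inner_add_right algebra_simps)
    moreover have "a ?y \<bullet> (?y - z) \<le> norm (a ?y) * norm (?y - z)" by (rule norm_cauchy_schwarz)
    moreover have "norm (?y - z) \<le> norm (z - P) + \<rho>"
    proof -
      have "?y - z = \<rho> *\<^sub>R b - (z - P)" by simp
      then show ?thesis using norm_triangle_ineq4[of "\<rho> *\<^sub>R b" "z - P"] nb \<rho>(1) by (simp add: algebra_simps)
    qed
    moreover have "norm (z - P) + \<rho> \<le> (1 + \<rho>) * (1 + norm (z - P))"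
      using \<rho>(1) by (simp add: algebra_simps)
    moreover have "norm (a ?y) \<le> (\<Sum>y\<in>V. norm (a y))"
      using finV y by (intro member_le_sum) auto
    ultimately show ?thesis
      unfolding K_def mult.assoc
      by (smt (verit) S0 mult_mono norm_ge_zero)
  qed
  have main: "\<rho> / n * norm w \<le> w \<bullet> (z - P) + K * (1 + norm (z - P))" if w: "w \<in> A z" for w z
  proof -
    let ?R = "w \<bullet> (z - P) + K * (1 + norm (z - P))"
    have "\<rho> * \<bar>w \<bullet> b\<bar> \<le> ?R" if "b \<in> Basis" for b
      using dir[OF w, of b] dir[OF w, of "- b"] that by (auto simp: abs_if)
    then have "(\<Sum>b\<in>Basis. \<rho> * \<bar>w \<bullet> b\<bar>) \<le> n * ?R"
      unfolding n_def by (intro sum_bounded_above)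
    moreover have "\<rho> * norm w \<le> \<rho> * (\<Sum>b\<in>Basis. \<bar>w \<bullet> b\<bar>)"
      using norm_le_l1[of w] \<rho>(1) by simp
    ultimately have "\<rho> * norm w \<le> n * ?R" by (simp add: sum_distrib_left)
    then show ?thesis using n by (simp add: field_simps)
  qed
  show thesis using that[of "\<rho> / n" K] main K0 \<rho>(1) n by simp
qed

lemma monotone_locally_bounded:
  fixes A :: "real^'n \<Rightarrow> (real^'n) set"
  assumes mono: "monotone_op A" and P: "P \<in> interior (dom_op A)"
  obtains \<delta> M where "\<delta> > 0" "\<And>z w. norm (z - P) \<le> \<delta> \<Longrightarrow> w \<in> A z \<Longrightarrow> norm w \<le> M"
proof -
  obtain r K where rK: "r > 0" "K \<ge> 0"
    "\<And>z w. w \<in> A z \<Longrightarrow> r * norm w \<le> w \<bullet> (z - P) + K * (1 + norm (z - P))"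
    using monotone_coercive_bound[OF mono P] by blast
  have "norm w \<le> 2 * K * (1 + r) / r" if z: "norm (z - P) \<le> r / 2" and w: "w \<in> A z" for z w
  proof -
    have "w \<bullet> (z - P) \<le> norm w * norm (z - P)" by (rule norm_cauchy_schwarz)
    also have "\<dots> \<le> norm w * (r / 2)" using z by (intro mult_left_mono) auto
    finally have "r / 2 * norm w \<le> K * (1 + norm (z - P))" using rK(3)[OF w] by (simp add: algebra_simps)
    also have "\<dots> \<le> K * (1 + r)" using z rK(1,2) by (intro mult_left_mono) auto
    finally show ?thesis using rK(1) by (simp add: field_simps)
  qed
  then show thesis using that[of "r/2"] rK(1) by (meson half_gt_zero)
qed

text \<open>
  Choose \<open>v \<in> A y\<close> with \<open>v \<bullet> e\<close> almost the smallest possible near \<open>p\<close>, and step back to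
  \<open>q = y - s e\<close>. Monotonicity makes the \<open>e\<close>-components of values of \<open>A\<close> at \<open>q\<close> at most \<open>v \<bullet> e\<close>,
  and by local boundedness almost so in a whole neighbourhood of \<open>q\<close>; by the choice of \<open>v\<close> they
  cannot be noticeably smaller either.
\<close>

lemma small_oscillation_dense:
  fixes A :: "real^'n \<Rightarrow> (real^'n) set" and e :: "real^'n"
  assumes mono: "monotone_op A" and p: "p \<in> interior (dom_op A)"
    and "\<epsilon> > 0" "\<eta> > 0" and e: "norm e = 1"
  obtains q \<rho> where "dist q p < \<eta>" "\<rho> > 0"
    "\<And>y y' v v'. y \<in> ball q \<rho> \<Longrightarrow> y' \<in> ball q \<rho> \<Longrightarrow> v \<in> A y \<Longrightarrow> v' \<in> A y' \<Longrightarrow> \<bar>(v - v') \<bullet> e\<bar> \<le> \<epsilon>"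
proof -
  obtain \<delta> M where \<delta>: "\<delta> > 0" "\<And>z w. norm (z - p) \<le> \<delta> \<Longrightarrow> w \<in> A z \<Longrightarrow> norm w \<le> M"
    using monotone_locally_bounded[OF mono p] by blast
  define h where "h = min \<delta> \<eta>"
  have h: "h > 0" "h \<le> \<delta>" "h \<le> \<eta>" using \<delta> assms by (auto simp: h_def)
  define X where "X = {v \<bullet> e | v y. y \<in> ball p h \<and> v \<in> A y}"
  have bd: "norm w \<le> M" if "z \<in> ball p h" "w \<in> A z" for z w
    using \<delta>(2)[of z w] that h by (auto simp: dist_norm norm_minus_commute)
  have "p \<in> dom_op A" using p interior_subset by blast
  then obtain v0 where v0: "v0 \<in> A p" by (auto simp: dom_op_def)
  then have "X \<noteq> {}" using h by (force simp: X_def)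
  have below: "- M \<le> t" if t: "t \<in> X" for t
  proof -
    obtain v y where vy: "t = v \<bullet> e" "y \<in> ball p h" "v \<in> A y" using t unfolding X_def by blast
    have "\<bar>v \<bullet> e\<bar> \<le> norm v * norm e" by (rule Cauchy_Schwarz_ineq2)
    then show ?thesis using bd[OF vy(2,3)] e vy(1) by auto
  qed
  then have bb: "bdd_below X" by (meson bdd_belowI)
  define m where "m = Inf X"
  obtain t where "t \<in> X" "t < m + \<epsilon> / 2"
    using cInf_lessD[OF \<open>X \<noteq> {}\<close>, of "m + \<epsilon>/2"] assms by (auto simp: m_def)
  then obtain v y where vy: "v \<bullet> e < m + \<epsilon> / 2" "y \<in> ball p h" "v \<in> A y" unfolding X_def by blast
  have lower: "m \<le> w \<bullet> e" if "z \<in> ball p h" "w \<in> A z" for z w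
    unfolding m_def using that bb by (intro cInf_lower) (auto simp: X_def)
  define s where "s = (h - dist p y) / 2"
  have sh: "dist p y + 2 * s = h" unfolding s_def by argo
  have s: "s > 0" using vy by (auto simp: s_def)
  define q where "q = y - s *\<^sub>R e"
  have M0: "M \<ge> 0" using bd[OF vy(2,3)] norm_ge_zero[of v] by linarith
  \<comment> \<open>Radius for which the error \<open>2 M \<rho> / s\<close> in \<open>upper\<close> below is at most \<open>\<epsilon> / 2\<close>.\<close>
  define \<rho> where "\<rho> = min s (s * \<epsilon> / (4 * (M + 1)))"
  have "\<rho> \<le> s * \<epsilon> / (4 * (M + 1))" by (simp add: \<rho>_def)
  then have "\<rho> * (4 * (M + 1)) \<le> s * \<epsilon>" using M0 by (subst (asm) pos_le_divide_eq) auto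
  moreover have "\<rho> > 0" "\<rho> \<le> s" using s assms M0 by (auto simp: \<rho>_def)
  ultimately have \<rho>: "\<rho> > 0" "\<rho> \<le> s" "\<rho> * (4 * (M + 1)) \<le> s * \<epsilon>" by auto
  have dq: "dist p q \<le> dist p y + s"
  proof -
    have "dist y q = s" using e s by (simp add: q_def dist_norm)
    then show ?thesis using dist_triangle[of p q y] by simp
  qed
  have inball: "z \<in> ball p h" if "z \<in> ball q \<rho>" for z
  proof -
    have "dist q z < \<rho>" using that by simp
    then have "dist p z < h" using dist_triangle[of p z q] dq sh \<rho>(2) by linarith
    then show ?thesis by simp
  qed
  have upper: "w \<bullet> e \<le> m + \<epsilon>" if z: "z \<in> ball q \<rho>" and w: "w \<in> A z" for z w
  proof -
    define d where "d = z - q"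
    have d: "norm d \<le> \<rho>" using z by (auto simp: d_def dist_norm norm_minus_commute)
    have nw: "norm (w - v) \<le> 2 * M"
      using norm_triangle_ineq4[of w v] bd[OF inball[OF z] w] bd[OF vy(2,3)] by simp
    have "z - y = d - s *\<^sub>R e" by (simp add: d_def q_def)
    moreover have "(w - v) \<bullet> (z - y) \<ge> 0" using mono w vy(3) by (auto simp: monotone_op_def)
    ultimately have "s * ((w - v) \<bullet> e) \<le> (w - v) \<bullet> d" by (simp add: inner_diff_right)
    also have "\<dots> \<le> norm (w - v) * norm d" by (rule norm_cauchy_schwarz)
    also have "\<dots> \<le> 2 * M * \<rho>" using nw d \<rho>(1) M0 by (intro mult_mono) auto
    also have "\<dots> \<le> s * (\<epsilon> / 2)" using \<rho> by (simp add: algebra_simps)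
    finally have "(w - v) \<bullet> e \<le> \<epsilon> / 2" using s by simp
    then show ?thesis using vy(1) by (simp add: inner_diff_left)
  qed
  have "dist q p < \<eta>" using dq sh s h(3) by (simp add: dist_commute)
  moreover have "\<bar>(v1 - v2) \<bullet> e\<bar> \<le> \<epsilon>"
    if "y1 \<in> ball q \<rho>" "y2 \<in> ball q \<rho>" "v1 \<in> A y1" "v2 \<in> A y2" for y1 y2 v1 v2
    using lower[OF inball[OF that(1)] that(3)] lower[OF inball[OF that(2)] that(4)]
      upper[OF that(1,3)] upper[OF that(2,4)] by (simp add: inner_diff_left abs_if)
  ultimately show thesis using that \<rho>(1) by blast
qed

text \<open>
  Baire's theorem: for each basis vector and each \<open>n\<close>, the points near which that component of \<open>A\<close>
  oscillates by at most \<open>1/(n+1)\<close> form an open dense set, and at a point of the interior of the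
  domain that lies in all of these sets the value of \<open>A\<close> is unique.
\<close>

lemma single_valued_dense:
  fixes A :: "real^'n \<Rightarrow> (real^'n) set"
  assumes mono: "monotone_op A"
  shows "interior (dom_op A) \<subseteq> closure (single_valued_pts A)"
proof
  fix p assume p: "p \<in> interior (dom_op A)"
  let ?U = "interior (dom_op A)"
  define good where "good e n \<rho> q \<longleftrightarrow> (\<forall>y\<in>ball q \<rho>. \<forall>y'\<in>ball q \<rho>. \<forall>v\<in>A y. \<forall>v'\<in>A y'. \<bar>(v - v') \<bullet> e\<bar> \<le> 1 / real (Suc n))"
    for e :: "real^'n" and n :: nat and \<rho> :: real and q :: "real^'n"
  \<comment> \<open>Adding the exterior makes each set dense in the whole space, where Baire applies.\<close>
  define G where "G e n = {q. \<exists>\<rho>>0. good e n \<rho> q} \<union> - closure ?U" for e :: "real^'n" and n :: nat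
  define F where "F = (\<lambda>(e,n). G e n) ` (Basis \<times> UNIV)"
  have op: "open (G e n)" for e n
  proof -
    have "open {q. \<exists>\<rho>>0. good e n \<rho> q}"
      unfolding open_dist
    proof clarify
      fix q \<rho> assume "\<rho> > 0" and g: "good e n \<rho> q"
      have "good e n (\<rho>/2) q'" if "dist q' q < \<rho>/2" for q'
      proof -
        have "ball q' (\<rho>/2) \<subseteq> ball q \<rho>" using that by (simp add: subset_iff dist_commute) (smt (verit) dist_triangle field_sum_of_halves)
        then show ?thesis using g unfolding good_def by blast
      qed
      then show "\<exists>\<epsilon>>0. \<forall>q'. dist q' q < \<epsilon> \<longrightarrow> q' \<in> {q. \<exists>\<rho>>0. good e n \<rho> q}"
        using \<open>\<rho> > 0\<close> by (intro exI[of _ "\<rho>/2"]) (auto intro!: exI[of _ "\<rho>/2"])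
    qed
    then show ?thesis by (auto simp: G_def open_Un)
  qed
  have dense: "x \<in> closure (G e n)" if e: "e \<in> Basis" for e n x
  proof (cases "x \<in> closure ?U")
    case False
    then have "x \<in> G e n" by (simp add: G_def)
    then show ?thesis using closure_subset by blast
  next
    case True
    show ?thesis unfolding closure_approachable
    proof (intro allI impI)
      fix \<epsilon> :: real assume "\<epsilon> > 0"
      then obtain p' where p': "p' \<in> ?U" "dist p' x < \<epsilon>/2"
        using True by (meson closure_approachable half_gt_zero)
      obtain q \<rho> where q: "dist q p' < \<epsilon>/2" "\<rho> > 0"
        "\<And>y y' v v'. y \<in> ball q \<rho> \<Longrightarrow> y' \<in> ball q \<rho> \<Longrightarrow> v \<in> A y \<Longrightarrow> v' \<in> A y' \<Longrightarrow> \<bar>(v - v') \<bullet> e\<bar> \<le> 1 / real (Suc n)"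
        by (rule small_oscillation_dense[OF mono p'(1), of "1 / real (Suc n)" "\<epsilon>/2" e])
          (use e \<open>\<epsilon> > 0\<close> in auto)
      have "q \<in> G e n" using q(2,3) by (auto simp: G_def good_def)
      moreover have "dist q x < \<epsilon>" using dist_triangle[of q x p'] q(1) p'(2) by simp
      ultimately show "\<exists>y\<in>G e n. dist y x < \<epsilon>" by blast
    qed
  qed
  have "(UNIV :: (real^'n) set) \<subseteq> closure (\<Inter>F)"
  proof (rule Baire)
    show "countable F" unfolding F_def
      by (intro countable_image countable_SIGMA) (auto intro: countable_finite)
    show "openin (top_of_set UNIV) T \<and> UNIV \<subseteq> closure T" if "T \<in> F" for T
      using that op dense by (auto simp: F_def)
  qed auto
  then have pc: "p \<in> closure (\<Inter>F)" by auto
  have sub: "?U \<inter> \<Inter>F \<subseteq> single_valued_pts A"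
  proof
    fix q assume q: "q \<in> ?U \<inter> \<Inter>F"
    then have "q \<in> dom_op A" using interior_subset by blast
    then obtain v where v: "v \<in> A q" by (auto simp: dom_op_def)
    have "v' = v" if v': "v' \<in> A q" for v'
    proof (rule euclidean_eqI)
      fix e :: "real^'n" assume e: "e \<in> Basis"
      have small: "\<bar>(v' - v) \<bullet> e\<bar> \<le> 1 / real (Suc n)" for n
      proof -
        have "q \<in> G e n" using q e by (force simp: F_def)
        moreover have "q \<in> closure ?U" using q closure_subset by blast
        ultimately obtain \<rho> where "\<rho> > 0" "good e n \<rho> q" by (auto simp: G_def)
        then show ?thesis using v v' centre_in_ball[of q \<rho>] unfolding good_def by blast
      qed
      have "\<not> 0 < \<bar>(v' - v) \<bullet> e\<bar>"
      proof
        assume "0 < \<bar>(v' - v) \<bullet> e\<bar>"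
        then obtain n where "inverse (real (Suc n)) < \<bar>(v' - v) \<bullet> e\<bar>" using reals_Archimedean by blast
        then show False using small[of n] by (simp add: inverse_eq_divide)
      qed
      then show "v' \<bullet> e = v \<bullet> e" by (simp add: inner_diff_left)
    qed
    then have "A q = {v}" using v by blast
    then show "q \<in> single_valued_pts A" using q by (auto simp: single_valued_pts_def)
  qed
  have "p \<in> closure (?U \<inter> \<Inter>F)"
    using open_Int_closure_subset[of ?U "\<Inter>F"] p pc by blast
  then show "p \<in> closure (single_valued_pts A)" using closure_mono[OF sub] by blast
qed

section \<open>Convexity of the domain\<close>

text \<open>
  For \<open>q\<close> in the interior of the convex hull, a value \<open>w \<in> A q\<close> has to satisfy
  \<open>w \<bullet> (y - q) \<le> v \<bullet> (y - q)\<close> for all \<open>v \<in> A y\<close>. It is obtained as the slope of a hyperplane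
  separating the convex hull of the pairs \<open>(y - q, v \<bullet> (y - q))\<close> from the open half-line below the
  origin. The two are disjoint: if \<open>q = \<Sum> u\<^sub>i y\<^sub>i\<close> is a convex combination, then
  \<open>2 \<Sum> u\<^sub>i v\<^sub>i \<bullet> (y\<^sub>i - q) = \<Sum>\<Sum> u\<^sub>i u\<^sub>j (v\<^sub>i - v\<^sub>j) \<bullet> (y\<^sub>i - y\<^sub>j)\<close>, which monotonicity makes
  nonnegative. The hyperplane is not vertical, since \<open>q\<close> is interior to the hull.
\<close>

lemma interior_convex_hull_dom_subset:
  fixes A :: "real^'n \<Rightarrow> (real^'n) set"
  assumes maxi: "maximal_monotone_op A"
  shows "interior (convex hull (dom_op A)) \<subseteq> dom_op A"
proof
  fix q assume q: "q \<in> interior (convex hull (dom_op A))"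
  have mono: "monotone_op A" using maxi by (simp add: maximal_monotone_op_def)
  define G where "G = {(y - q, v \<bullet> (y - q)) | y v. v \<in> A y}"
  define H where "H = {0 :: real^'n} \<times> {..<0::real}"
  have Hconv: "convex H" unfolding H_def by (intro convex_Times convex_singleton convex_real_interval)
  have "dom_op A \<noteq> {}" using q by auto
  then have Gne: "G \<noteq> {}" by (auto simp: G_def dom_op_def)
  have "(0, t) \<notin> convex hull G" if "t < 0" for t
  proof
    assume "(0, t) \<in> convex hull G"
    then obtain S u where S: "finite S" "S \<subseteq> G" "\<And>g. g \<in> S \<Longrightarrow> 0 \<le> u g" "sum u S = 1"
      "(\<Sum>g\<in>S. u g *\<^sub>R g) = (0, t)"
      by (auto simp: convex_hull_explicit)
    have "\<forall>g\<in>S. \<exists>y v. v \<in> A y \<and> fst g = y - q \<and> snd g = v \<bullet> (y - q)"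
      using S(2) by (fastforce simp: G_def)
    then obtain Y V where YV: "\<And>g. g \<in> S \<Longrightarrow> V g \<in> A (Y g)"
      "\<And>g. g \<in> S \<Longrightarrow> fst g = Y g - q" "\<And>g. g \<in> S \<Longrightarrow> snd g = V g \<bullet> (Y g - q)" by metis
    have z1: "(\<Sum>g\<in>S. u g *\<^sub>R (Y g - q)) = 0"
    proof -
      have "(\<Sum>g\<in>S. u g *\<^sub>R (Y g - q)) = (\<Sum>g\<in>S. fst (u g *\<^sub>R g))"
        by (intro sum.cong) (simp_all add: YV(2))
      then show ?thesis using S(5) by (metis fst_conv fst_sum)
    qed
    have z2: "(\<Sum>g\<in>S. u g * (V g \<bullet> (Y g - q))) = t"
    proof -
      have "(\<Sum>g\<in>S. u g * (V g \<bullet> (Y g - q))) = (\<Sum>g\<in>S. snd (u g *\<^sub>R g))"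
        by (intro sum.cong) (simp_all add: YV(3))
      then show ?thesis using S(5) by (metis snd_conv snd_sum)
    qed
    define W where "W = (\<Sum>g\<in>S. u g *\<^sub>R V g)"
    have nonneg: "0 \<le> t - W \<bullet> (Y h - q) + V h \<bullet> (Y h - q)" if h: "h \<in> S" for h
    proof -
      have "0 \<le> (\<Sum>g\<in>S. u g * ((V g - V h) \<bullet> (Y g - Y h)))"
        using S(3) YV(1) h mono by (intro sum_nonneg mult_nonneg_nonneg) (auto simp: monotone_op_def)
      also have "\<dots> = (\<Sum>g\<in>S. u g * (V g \<bullet> (Y g - q)) - (u g *\<^sub>R V g) \<bullet> (Y h - q)
          - V h \<bullet> (u g *\<^sub>R (Y g - q)) + u g * (V h \<bullet> (Y h - q)))"
        by (intro sum.cong) (simp_all add: inner_diff_left inner_diff_right algebra_simps)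
      also have "\<dots> = t - W \<bullet> (Y h - q) + V h \<bullet> (Y h - q)"
        by (simp only: W_def sum.distrib sum_subtractf z1 z2 S(4) inner_zero_right mult_1 diff_0_right
            flip: inner_sum_left inner_sum_right sum_distrib_right)
      finally show ?thesis .
    qed
    have "0 \<le> (\<Sum>h\<in>S. u h * (t - W \<bullet> (Y h - q) + V h \<bullet> (Y h - q)))"
      using nonneg S(3) by (intro sum_nonneg mult_nonneg_nonneg)
    also have "\<dots> = (\<Sum>h\<in>S. u h * t - W \<bullet> (u h *\<^sub>R (Y h - q)) + u h * (V h \<bullet> (Y h - q)))"
      by (intro sum.cong) (simp_all add: algebra_simps)
    also have "\<dots> = t - 0 + t"
      by (simp only: sum.distrib sum_subtractf z1 z2 S(4) inner_zero_right mult_1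
          flip: inner_sum_right sum_distrib_right)
    finally show False using \<open>t < 0\<close> by simp
  qed
  then have "H \<inter> convex hull G = {}" by (auto simp: H_def)
  moreover have "H \<noteq> {}" by (auto simp: H_def intro: exI[of _ "-1"])
  ultimately obtain ab b where sep: "ab \<noteq> 0" "\<And>z. z \<in> H \<Longrightarrow> ab \<bullet> z \<le> b"
      "\<And>z. z \<in> convex hull G \<Longrightarrow> b \<le> ab \<bullet> z"
    using separating_hyperplane_sets[OF Hconv convex_convex_hull[of G]] Gne by (metis convex_hull_eq_empty)
  obtain \<alpha> \<beta> where ab: "ab = (\<alpha>, \<beta>)" by fastforce
  have neg: "\<beta> * t \<le> b" if "t < 0" for t using sep(2)[of "(0, t)"] that by (simp add: ab H_def)
  have pos: "b \<le> \<alpha> \<bullet> (y - q) + \<beta> * (v \<bullet> (y - q))" if "v \<in> A y" for y v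
    using sep(3)[of "(y - q, v \<bullet> (y - q))"] that hull_subset[of G convex] by (auto simp: ab G_def)
  have \<beta>: "\<beta> \<ge> 0"
  proof (rule ccontr)
    assume "\<not> \<beta> \<ge> 0"
    then show False using neg[of "(\<bar>b\<bar> + 1) / \<beta>"] by (auto simp: divide_pos_neg)
  qed
  have b: "b \<ge> 0"
  proof (rule ccontr)
    assume "\<not> b \<ge> 0"
    then have "b * (\<beta> + 2) \<ge> b * \<beta>  \<Longrightarrow> False" by (simp add: algebra_simps)
    moreover have "\<beta> * (b / (\<beta> + 2)) \<le> b" using \<beta> \<open>\<not> b \<ge> 0\<close> by (intro neg) (simp add: divide_neg_pos)
    ultimately show False using \<beta> by (simp add: field_simps)
  qed
  have "\<beta> \<noteq> 0"
  proof
    assume "\<beta> = 0"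
    then have \<alpha>: "\<alpha> \<noteq> 0" using sep(1) ab by (auto simp: zero_prod_def)
    have "dom_op A \<subseteq> {y. \<alpha> \<bullet> y \<ge> \<alpha> \<bullet> q}"
      using pos b \<open>\<beta> = 0\<close> by (force simp: dom_op_def inner_diff_right)
    then have sub: "convex hull (dom_op A) \<subseteq> {y. \<alpha> \<bullet> y \<ge> \<alpha> \<bullet> q}"
      by (intro hull_minimal convex_halfspace_ge)
    obtain e where e: "e > 0" "cball q e \<subseteq> convex hull (dom_op A)"
      using q mem_interior_cball by blast
    have "q - (e / norm \<alpha>) *\<^sub>R \<alpha> \<in> cball q e" using e \<alpha> by (simp add: dist_norm)
    then have "\<alpha> \<bullet> (q - (e / norm \<alpha>) *\<^sub>R \<alpha>) \<ge> \<alpha> \<bullet> q" using e sub by blast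
    then have "e / norm \<alpha> * (\<alpha> \<bullet> \<alpha>) \<le> 0" by (simp add: inner_diff_right)
    moreover have "e / norm \<alpha> * (\<alpha> \<bullet> \<alpha>) > 0" using e \<alpha> by simp
    ultimately show False by linarith
  qed
  then have \<beta>: "\<beta> > 0" using \<beta> by simp
  have "(- \<alpha> /\<^sub>R \<beta> - u) \<bullet> (q - y) \<ge> 0" if "u \<in> A y" for y u
  proof -
    have "0 \<le> (\<alpha> \<bullet> (y - q) + \<beta> * (u \<bullet> (y - q))) / \<beta>" using pos[OF that] b \<beta> by simp
    also have "\<dots> = (- \<alpha> /\<^sub>R \<beta> - u) \<bullet> (q - y)"
      using \<beta> by (simp add: inner_diff_left inner_diff_right field_simps)
    finally show ?thesis .
  qed
  then have "- \<alpha> /\<^sub>R \<beta> \<in> A q" using maximal_monotone_mem_iff[OF maxi] by blast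
  then show "q \<in> dom_op A" by (auto simp: dom_op_def)
qed

lemma interior_dom_eq_hull:
  fixes A :: "real^'n \<Rightarrow> (real^'n) set"
  assumes "maximal_monotone_op A"
  shows "interior (dom_op A) = interior (convex hull (dom_op A))"
  by (metis assms hull_subset interior_convex_hull_dom_subset interior_maximal interior_mono open_interior subset_antisym)

lemma closure_dom_eq_hull:
  fixes A :: "real^'n \<Rightarrow> (real^'n) set"
  assumes "maximal_monotone_op A" "interior (dom_op A) \<noteq> {}"
  shows "closure (dom_op A) = closure (convex hull (dom_op A))"
    and "closure (interior (dom_op A)) = closure (dom_op A)"
proof -
  have "closure (interior (dom_op A)) = closure (convex hull (dom_op A))"
    using convex_closure_interior[OF convex_convex_hull[of "dom_op A"]]
      interior_dom_eq_hull[OF assms(1)] assms(2) by metis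
  moreover have "closure (interior (dom_op A)) \<subseteq> closure (dom_op A)"
    by (simp add: closure_mono interior_subset)
  moreover have "closure (dom_op A) \<subseteq> closure (convex hull (dom_op A))"
    by (simp add: closure_mono hull_subset)
  ultimately show "closure (dom_op A) = closure (convex hull (dom_op A))"
    and "closure (interior (dom_op A)) = closure (dom_op A)" by auto
qed

lemma segment_into_interior_dom:
  fixes A :: "real^'n \<Rightarrow> (real^'n) set"
  assumes "maximal_monotone_op A" "p \<in> interior (dom_op A)" "x \<in> closure (dom_op A)" "0 < e" "e \<le> 1"
  shows "x + e *\<^sub>R (p - x) \<in> interior (dom_op A)"
proof -
  have "interior (dom_op A) \<noteq> {}" using assms by auto
  then have "x - e *\<^sub>R (x - p) \<in> interior (convex hull (dom_op A))"
    using assms closure_dom_eq_hull[OF assms(1)] interior_dom_eq_hull[OF assms(1)]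
    by (intro mem_interior_closure_convex_shrink) auto
  then show ?thesis using interior_dom_eq_hull[OF assms(1)] by (simp add: algebra_simps)
qed

text \<open>
  A vector in the polar of the normal cone at \<open>x\<close> is tangent to the closed domain, and an
  arbitrarily small push towards an interior point \<open>p\<close> makes it point into the interior.
  Otherwise a hyperplane would separate the ray from the interior of the domain. Its normal is then
  a normal vector at \<open>x\<close>, so it makes a nonpositive product with \<open>u\<close> and a negative one with
  \<open>p - x\<close>, whereas its product with the direction of the ray is nonnegative.
\<close>

lemma ray_enters_interior_dom:
  fixes A :: "real^'n \<Rightarrow> (real^'n) set"
  assumes maxi: "maximal_monotone_op A" and p: "p \<in> interior (dom_op A)"
    and x: "x \<in> closure (dom_op A)"
    and u: "\<And>n. n \<in> normal_cone (closure (dom_op A)) x \<Longrightarrow> n \<bullet> u \<le> 0" and "\<epsilon> > 0"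
  shows "\<exists>s>0. x + s *\<^sub>R (u + \<epsilon> *\<^sub>R (p - x)) \<in> interior (dom_op A)"
proof (rule ccontr)
  define u' where "u' = u + \<epsilon> *\<^sub>R (p - x)"
  assume "\<not> ?thesis"
  then have out: "x + s *\<^sub>R u' \<notin> interior (dom_op A)" if "s > 0" for s
    using that by (auto simp: u'_def)
  let ?U = "interior (dom_op A)"
  define R where "R = (\<lambda>s. x + s *\<^sub>R u') ` {0<..}"
  have "convex R"
  proof -
    have "convex ((\<lambda>s. s *\<^sub>R u') ` {0::real<..})"
      by (intro convex_linear_image convex_real_interval) (simp add: linear_iff scaleR_add_left)
    then have "convex ((+) x ` ((\<lambda>s. s *\<^sub>R u') ` {0::real<..}))" by (rule convex_translation)
    then show ?thesis by (simp add: R_def image_image)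
  qed
  moreover have "convex ?U" using interior_dom_eq_hull[OF maxi] by (simp add: convex_interior)
  moreover have "?U \<inter> R = {}" using out by (auto simp: R_def)
  moreover have "R \<noteq> {}" "?U \<noteq> {}" using p by (auto simp: R_def)
  ultimately obtain a b where ab: "a \<noteq> 0" "\<And>y. y \<in> ?U \<Longrightarrow> a \<bullet> y \<le> b" "\<And>y. y \<in> R \<Longrightarrow> b \<le> a \<bullet> y"
    by (metis separating_hyperplane_sets)
  have "closure ?U \<subseteq> {y. a \<bullet> y \<le> b}" using ab(2) by (intro closure_minimal closed_halfspace_le) auto
  then have C: "a \<bullet> y \<le> b" if "y \<in> closure (dom_op A)" for y
    using that closure_dom_eq_hull(2)[OF maxi] p by blast
  have ray: "b \<le> a \<bullet> x + s * (a \<bullet> u')" if "s > 0" for s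
    using ab(3)[of "x + s *\<^sub>R u'"] that by (auto simp: R_def inner_add_right)
  have "b \<le> a \<bullet> x"
  proof (rule ccontr)
    assume "\<not> b \<le> a \<bullet> x"
    then have pos: "b - a \<bullet> x > 0" by simp
    define k where "k = \<bar>a \<bullet> u'\<bar> + 1"
    have k: "k > 0" "a \<bullet> u' < k" by (auto simp: k_def)
    have "b \<le> a \<bullet> x + (b - a \<bullet> x) / k * (a \<bullet> u')" using pos k by (intro ray) simp
    also have "(b - a \<bullet> x) / k * (a \<bullet> u') < (b - a \<bullet> x) / k * k"
      using pos k by (intro mult_strict_left_mono) auto
    finally show False using k by simp
  qed
  then have ax: "a \<bullet> x = b" using C[OF x] by simp
  then have "a \<in> normal_cone (closure (dom_op A)) x"
    using x C by (auto simp: normal_cone_def inner_diff_right)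
  then have "a \<bullet> u \<le> 0" by (rule u)
  moreover have "0 \<le> a \<bullet> u'" using ray[of 1] ax by simp
  ultimately have "0 \<le> \<epsilon> * (a \<bullet> (p - x))" by (simp add: u'_def inner_add_right)
  then have ap: "b \<le> a \<bullet> p" using ax \<open>\<epsilon> > 0\<close> by (simp add: zero_le_mult_iff inner_diff_right)
  obtain e where e: "e > 0" "cball p e \<subseteq> ?U" using p by (metis open_interior open_contains_cball)
  have "p + (e / norm a) *\<^sub>R a \<in> cball p e" using e ab(1) by (simp add: dist_norm)
  then have "a \<bullet> (p + (e / norm a) *\<^sub>R a) \<le> b" using e(2) by (intro ab(2)) blast
  then have "e / norm a * (a \<bullet> a) \<le> 0" using ap by (simp add: inner_add_right)
  moreover have "e / norm a * (a \<bullet> a) > 0" using e ab(1) by simp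
  ultimately show False by linarith
qed

section \<open>Representation of A by limits of single values and normals\<close>

lemma closed_convex_values:
  assumes "maximal_monotone_op A"
  shows "closed (A x)" "convex (A x)"
proof -
  have eq: "A x = (\<Inter>y. \<Inter>u\<in>A y. {v. (x - y) \<bullet> v \<ge> (x - y) \<bullet> u})"
    by (auto simp: maximal_monotone_mem_iff[OF assms, of _ x] inner_diff_left inner_commute)
  show "closed (A x)" by (subst eq) (intro closed_INT ballI closed_halfspace_ge)
  show "convex (A x)" by (subst eq) (intro convex_INT convex_halfspace_ge)
qed

lemma maximal_monotone_closed_graph:
  assumes maxi: "maximal_monotone_op A" and "xs \<longlonglongrightarrow> x" "vs \<longlonglongrightarrow> v" "\<And>k. vs k \<in> A (xs k)"
  shows "v \<in> A x"
  unfolding maximal_monotone_mem_iff[OF maxi]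
proof (intro allI ballI)
  fix y u assume "u \<in> A y"
  have "(\<lambda>k. (vs k - u) \<bullet> (xs k - y)) \<longlonglongrightarrow> (v - u) \<bullet> (x - y)" by (intro tendsto_intros assms)
  moreover have "0 \<le> (vs k - u) \<bullet> (xs k - y)" for k
    using maximal_monotone_mem_iff[OF maxi] assms(4) \<open>u \<in> A y\<close> by blast
  ultimately show "0 \<le> (v - u) \<bullet> (x - y)" by (intro LIMSEQ_le_const) auto
qed

lemma A0_subset:
  assumes "maximal_monotone_op A"
  shows "A0 A x \<subseteq> A x"
  using maximal_monotone_closed_graph[OF assms] by (fastforce simp: A0_def)

lemma clco_A0_subset:
  assumes "maximal_monotone_op A"
  shows "clco (A0 A x) \<subseteq> A x"
  unfolding clco_def using A0_subset[OF assms] closed_convex_values[OF assms]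
  by (intro closure_minimal hull_minimal)

lemma add_normal_cone_mem:
  assumes maxi: "maximal_monotone_op A" and v: "v \<in> A x" and n: "n \<in> normal_cone (closure (dom_op A)) x"
  shows "v + n \<in> A x"
  unfolding maximal_monotone_mem_iff[OF maxi]
proof (intro allI ballI)
  fix y u assume "u \<in> A y"
  then have "y \<in> closure (dom_op A)" using closure_subset by (force simp: dom_op_def)
  then have "n \<bullet> (y - x) \<le> 0" using n by (auto simp: normal_cone_def split: if_splits)
  moreover have "(v - u) \<bullet> (x - y) \<ge> 0" using maximal_monotone_mem_iff[OF maxi] v \<open>u \<in> A y\<close> by blast
  ultimately show "(v + n - u) \<bullet> (x - y) \<ge> 0"
    by (simp add: inner_diff_left inner_diff_right inner_add_left)
qed

text \<open>
  The vector \<open>w\<close> is a limit of the values \<open>w\<^sub>k\<close> of \<open>A\<close> at single-valued points \<open>z\<^sub>k\<close> that approach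
  \<open>x\<close> along the ray of direction \<open>u\<close>. Monotonicity against \<open>v \<in> A x\<close> gives
  \<open>w\<^sub>k \<bullet> u \<ge> v \<bullet> u - o(1)(1 + |w\<^sub>k|)\<close>, provided \<open>z\<^sub>k\<close> lies off the ray by much less than its
  distance to \<open>x\<close>. The same inequality bounds \<open>w\<^sub>k \<bullet> (z\<^sub>k - P)\<close> from above for the point
  \<open>P\<close> further along the ray, so that the coercivity estimate at \<open>P\<close> keeps \<open>w\<^sub>k\<close> bounded.
\<close>

lemma A0_directional_lower_bound:
  fixes A :: "real^'n \<Rightarrow> (real^'n) set"
  assumes maxi: "maximal_monotone_op A" and v: "v \<in> A x"
    and s: "s > 0" "x + s *\<^sub>R u \<in> interior (dom_op A)"
  obtains w where "w \<in> A0 A x" "v \<bullet> u \<le> w \<bullet> u"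
proof -
  have mono: "monotone_op A" using maxi by (simp add: maximal_monotone_op_def)
  have x: "x \<in> closure (dom_op A)" using v closure_subset by (force simp: dom_op_def)
  define P where "P = x + s *\<^sub>R u"
  obtain r K where rK: "r > 0" "K \<ge> 0"
    "\<And>z w. w \<in> A z \<Longrightarrow> r * norm w \<le> w \<bullet> (z - P) + K * (1 + norm (z - P))"
    using monotone_coercive_bound[OF mono s(2)[folded P_def]] by blast
  define \<theta> :: "nat \<Rightarrow> real" where "\<theta> k = inverse (real (Suc k))" for k
  have \<theta>: "0 < \<theta> k" "\<theta> k \<le> 1" for k by (auto simp: \<theta>_def field_simps)
  have \<theta>0: "\<theta> \<longlonglongrightarrow> 0" unfolding \<theta>_def by (rule LIMSEQ_inverse_real_of_nat)
  \<comment> \<open>The two error terms in the bound for \<open>w k\<close> then cost at most half of \<open>r * norm (w k)\<close>.\<close>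
  define \<eta> where "\<eta> = r / (4 * (s + 1))"
  have \<eta>: "\<eta> > 0" "\<eta> * s \<le> r / 4" using rK(1) s(1) by (auto simp: \<eta>_def field_simps)
  have "\<exists>z\<in>single_valued_pts A. dist z (x + (\<theta> k * s) *\<^sub>R u) < \<theta> k * s * (\<eta> * \<theta> k)" for k
  proof -
    have "x + \<theta> k *\<^sub>R (P - x) \<in> interior (dom_op A)"
      using segment_into_interior_dom[OF maxi _ x \<theta>, of P k] s(2) by (simp add: P_def)
    then have "x + (\<theta> k * s) *\<^sub>R u \<in> closure (single_valued_pts A)"
      using single_valued_dense[OF mono] by (auto simp: P_def)
    moreover have "0 < \<theta> k * s * (\<eta> * \<theta> k)" using \<theta> s \<eta> by simp
    ultimately show ?thesis by (meson closure_approachable)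
  qed
  then obtain z where z: "\<And>k. z k \<in> single_valued_pts A"
    "\<And>k. dist (z k) (x + (\<theta> k * s) *\<^sub>R u) < \<theta> k * s * (\<eta> * \<theta> k)" by metis
  have "\<forall>k. \<exists>w. A (z k) = {w}" using z(1) by (auto simp: single_valued_pts_def is_singleton_def)
  then obtain w where w: "\<And>k. A (z k) = {w k}" by metis
  define d where "d k = z k - (x + (\<theta> k * s) *\<^sub>R u)" for k
  have d: "norm (d k) \<le> \<theta> k * s * (\<eta> * \<theta> k)" for k using z(2)[of k] by (simp add: d_def dist_norm)
  have wu: "v \<bullet> u - (norm (w k) + norm v) * (\<eta> * \<theta> k) \<le> w k \<bullet> u" for k
  proof -
    have "0 \<le> (w k - v) \<bullet> (z k - x)" using mono v w[of k] by (auto simp: monotone_op_def)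
    also have "z k - x = (\<theta> k * s) *\<^sub>R u + d k" by (simp add: d_def)
    also have "(w k - v) \<bullet> \<dots> \<le> \<theta> k * s * ((w k - v) \<bullet> u) + norm (w k - v) * norm (d k)"
      using norm_cauchy_schwarz[of "w k - v" "d k"] by (simp add: inner_add_right)
    also have "norm (w k - v) * norm (d k) \<le> (norm (w k) + norm v) * (\<theta> k * s * (\<eta> * \<theta> k))"
      using d norm_triangle_ineq4 by (intro mult_mono) auto
    finally have "0 \<le> \<theta> k * s * ((w k - v) \<bullet> u + (norm (w k) + norm v) * (\<eta> * \<theta> k))"
      by (simp add: algebra_simps)
    then have "0 \<le> (w k - v) \<bullet> u + (norm (w k) + norm v) * (\<eta> * \<theta> k)"
      using mult_pos_pos[OF \<theta>(1)[of k] s(1)] by (simp only: zero_le_mult_iff) auto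
    then show ?thesis by (simp add: inner_diff_left)
  qed
  define M where "M = s * \<bar>v \<bullet> u\<bar> + s * \<eta> * norm v + K * (1 + s * norm u + s * \<eta>)"
  have bound: "norm (w k) \<le> 2 * M / r" for k
  proof -
    have "\<theta> k * \<theta> k \<le> 1" using \<theta>[of k] by (simp add: mult_le_one)
    then have "(s * \<eta>) * (\<theta> k * \<theta> k) \<le> s * \<eta>" using s(1) \<eta>(1) by (intro mult_left_le) auto
    then have dk: "norm (d k) \<le> s * \<eta>" using d[of k] by (simp add: algebra_simps)
    have zP: "z k - P = d k - (s * (1 - \<theta> k)) *\<^sub>R u"
      by (simp add: d_def P_def algebra_simps)
    have c: "0 \<le> s * (1 - \<theta> k)" "s * (1 - \<theta> k) \<le> s" using \<theta>[of k] s(1) by auto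
    have "norm (z k - P) \<le> norm (d k) + s * (1 - \<theta> k) * norm u"
      unfolding zP using norm_triangle_ineq4[of "d k" "(s * (1 - \<theta> k)) *\<^sub>R u"] c(1) by simp
    also have "\<dots> \<le> s * \<eta> + s * norm u" using dk c(2) by (intro add_mono mult_right_mono) auto
    finally have nz: "K * (1 + norm (z k - P)) \<le> K * (1 + s * norm u + s * \<eta>)"
      using rK(2) by (intro mult_left_mono) auto
    have "v \<bullet> u - (norm (w k) + norm v) * \<eta> \<le> v \<bullet> u - (norm (w k) + norm v) * (\<eta> * \<theta> k)"
      using \<theta>[of k] \<eta>(1) by (intro diff_left_mono mult_left_mono) auto
    then have "- (\<bar>v \<bullet> u\<bar> + (norm (w k) + norm v) * \<eta>) \<le> w k \<bullet> u" using wu[of k] by linarith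
    then have "s * (1 - \<theta> k) * (- (w k \<bullet> u)) \<le> s * (1 - \<theta> k) * (\<bar>v \<bullet> u\<bar> + (norm (w k) + norm v) * \<eta>)"
      using c(1) by (intro mult_left_mono) auto
    also have "\<dots> \<le> s * (\<bar>v \<bullet> u\<bar> + (norm (w k) + norm v) * \<eta>)"
      using c(2) \<eta>(1) by (intro mult_right_mono) auto
    finally have 1: "s * (1 - \<theta> k) * (- (w k \<bullet> u)) \<le> s * \<bar>v \<bullet> u\<bar> + s * \<eta> * norm v + (\<eta> * s) * norm (w k)"
      by (simp add: algebra_simps)
    have 2: "w k \<bullet> d k \<le> (\<eta> * s) * norm (w k)"
      using norm_cauchy_schwarz[of "w k" "d k"] mult_left_mono[OF dk, of "norm (w k)"] by (simp add: algebra_simps)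
    have "w k \<bullet> (z k - P) = w k \<bullet> d k + s * (1 - \<theta> k) * (- (w k \<bullet> u))"
      by (simp add: zP inner_diff_right)
    then have "r * norm (w k) \<le> M + 2 * ((\<eta> * s) * norm (w k))"
      using 1 2 nz rK(3)[of "w k" "z k"] w[of k] by (simp add: M_def)
    also have "(\<eta> * s) * norm (w k) \<le> r / 4 * norm (w k)" using \<eta>(2) by (intro mult_right_mono) auto
    finally show ?thesis using rK(1) by (simp add: field_simps)
  qed
  then have "bounded (range w)" by (auto simp: bounded_iff)
  then obtain l \<sigma> where l: "strict_mono \<sigma>" "(w \<circ> \<sigma>) \<longlonglongrightarrow> l"
    using bounded_imp_convergent_subsequence by blast
  have "z \<longlonglongrightarrow> x"
  proof -
    have "d \<longlonglongrightarrow> 0"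
    proof (rule Lim_null_comparison)
      show "\<forall>\<^sub>F k in sequentially. norm (d k) \<le> \<theta> k * s * (\<eta> * \<theta> k)" using d by simp
      show "(\<lambda>k. \<theta> k * s * (\<eta> * \<theta> k)) \<longlonglongrightarrow> 0" by (rule tendsto_eq_intros \<theta>0 | simp)+
    qed
    then have "(\<lambda>k. d k + (x + (\<theta> k * s) *\<^sub>R u)) \<longlonglongrightarrow> 0 + (x + (0 * s) *\<^sub>R u)"
      by (intro tendsto_intros \<theta>0)
    then show ?thesis by (simp add: d_def)
  qed
  then have zx: "(z \<circ> \<sigma>) \<longlonglongrightarrow> x" using l(1) LIMSEQ_subseq_LIMSEQ by blast
  have "l \<in> A0 A x"
    unfolding A0_def mem_Collect_eq
  proof (intro exI conjI)
    show "\<forall>k. (z \<circ> \<sigma>) k \<in> single_valued_pts A \<and> A ((z \<circ> \<sigma>) k) = {(w \<circ> \<sigma>) k}" using z(1) w by simp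
  qed (rule zx l(2))+
  moreover have "v \<bullet> u \<le> l \<bullet> u"
  proof (rule LIMSEQ_le)
    have "(\<theta> \<circ> \<sigma>) \<longlonglongrightarrow> 0" using l(1) \<theta>0 LIMSEQ_subseq_LIMSEQ by blast
    then have "(\<lambda>k. v \<bullet> u - (norm ((w \<circ> \<sigma>) k) + norm v) * (\<eta> * (\<theta> \<circ> \<sigma>) k)) \<longlonglongrightarrow>
        v \<bullet> u - (norm l + norm v) * (\<eta> * 0)"
      by (intro tendsto_intros l(2))
    then show "(\<lambda>k. v \<bullet> u - (norm ((w \<circ> \<sigma>) k) + norm v) * (\<eta> * (\<theta> \<circ> \<sigma>) k)) \<longlonglongrightarrow> v \<bullet> u" by simp
    show "(\<lambda>k. (w \<circ> \<sigma>) k \<bullet> u) \<longlonglongrightarrow> l \<bullet> u" by (intro tendsto_intros l(2))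
    show "\<exists>N. \<forall>k\<ge>N. v \<bullet> u - (norm ((w \<circ> \<sigma>) k) + norm v) * (\<eta> * (\<theta> \<circ> \<sigma>) k) \<le> (w \<circ> \<sigma>) k \<bullet> u"
      using wu by auto
  qed
  ultimately show thesis using that by blast
qed

text \<open>
  A sum of closed sets is closed when the summands of a convergent sequence stay bounded. Here the
  summand \<open>c\<close> lies in \<open>A x\<close> and the normal summand has a nonnegative product with \<open>x - P\<close>; hence
  \<open>c \<bullet> (x - P)\<close> is bounded above by the product of the whole sum, and the coercivity estimate at the
  interior point \<open>P\<close> applies.
\<close>

lemma closed_clco_A0_plus_normal_cone:
  fixes A :: "real^'n \<Rightarrow> (real^'n) set"
  assumes maxi: "maximal_monotone_op A" and int: "interior (dom_op A) \<noteq> {}"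
  shows "closed (clco (A0 A x) + normal_cone (closure (dom_op A)) x)"
  unfolding closed_sequential_limits
proof (intro allI impI, elim conjE)
  let ?C = "closure (dom_op A)"
  fix s l assume s: "\<forall>k. s k \<in> clco (A0 A x) + normal_cone ?C x" and sl: "s \<longlonglongrightarrow> l"
  have mono: "monotone_op A" using maxi by (simp add: maximal_monotone_op_def)
  obtain P where P: "P \<in> interior (dom_op A)" using int by auto
  then have PC: "P \<in> ?C" using interior_subset closure_subset by blast
  obtain r K where rK: "r > 0" "K \<ge> 0"
    "\<And>z w. w \<in> A z \<Longrightarrow> r * norm w \<le> w \<bullet> (z - P) + K * (1 + norm (z - P))"
    using monotone_coercive_bound[OF mono P] by blast
  have "\<forall>k. \<exists>c n. s k = c + n \<and> c \<in> clco (A0 A x) \<and> n \<in> normal_cone ?C x"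
    using s by (fastforce simp: set_plus_def)
  then obtain c n where cn: "\<And>k. s k = c k + n k" "\<And>k. c k \<in> clco (A0 A x)" "\<And>k. n k \<in> normal_cone ?C x"
    by metis
  have x: "x \<in> ?C" using cn(3)[of 0] by (auto simp: normal_cone_def split: if_splits)
  obtain B where B: "\<And>k. norm (s k) \<le> B"
    using convergent_imp_bounded[OF sl] by (auto simp: bounded_iff)
  have "norm (c k) \<le> (B * norm (x - P) + K * (1 + norm (x - P))) / r" for k
  proof -
    have "n k \<bullet> (P - x) \<le> 0" using cn(3)[of k] PC x by (auto simp: normal_cone_def)
    then have "c k \<bullet> (x - P) \<le> s k \<bullet> (x - P)"
      by (simp add: cn(1) inner_add_left inner_diff_right)
    also have "\<dots> \<le> norm (s k) * norm (x - P)" by (rule norm_cauchy_schwarz)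
    also have "\<dots> \<le> B * norm (x - P)" using B by (intro mult_right_mono) auto
    finally have "r * norm (c k) \<le> B * norm (x - P) + K * (1 + norm (x - P))"
      using rK(3)[of "c k" x] cn(2)[of k] clco_A0_subset[OF maxi] by fastforce
    then show ?thesis using rK(1) by (simp add: field_simps)
  qed
  then have "bounded (range c)" by (auto simp: bounded_iff)
  then obtain c0 \<sigma> where \<sigma>: "strict_mono \<sigma>" "(c \<circ> \<sigma>) \<longlonglongrightarrow> c0"
    using bounded_imp_convergent_subsequence by blast
  have c0: "c0 \<in> clco (A0 A x)"
    using closed_sequentially[OF _ _ \<sigma>(2), of "clco (A0 A x)"] cn(2) by (simp add: clco_def)
  have "(s \<circ> \<sigma>) \<longlonglongrightarrow> l" using \<sigma>(1) sl LIMSEQ_subseq_LIMSEQ by blast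
  then have nl: "(\<lambda>k. (s \<circ> \<sigma>) k - (c \<circ> \<sigma>) k) \<longlonglongrightarrow> l - c0" using \<sigma>(2) by (rule tendsto_diff)
  have "(l - c0) \<bullet> (y - x) \<le> 0" if "y \<in> ?C" for y
  proof (rule LIMSEQ_le_const2)
    show "(\<lambda>k. ((s \<circ> \<sigma>) k - (c \<circ> \<sigma>) k) \<bullet> (y - x)) \<longlonglongrightarrow> (l - c0) \<bullet> (y - x)"
      by (intro tendsto_intros nl)
    show "\<exists>N. \<forall>k\<ge>N. ((s \<circ> \<sigma>) k - (c \<circ> \<sigma>) k) \<bullet> (y - x) \<le> 0"
      using cn(3) that x by (auto simp: cn(1) normal_cone_def)
  qed
  then have "l - c0 \<in> normal_cone ?C x" using x by (simp add: normal_cone_def)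
  then have "c0 + (l - c0) \<in> clco (A0 A x) + normal_cone ?C x" using c0 by (rule set_plus_intro[rotated])
  then show "l \<in> clco (A0 A x) + normal_cone ?C x" by simp
qed

lemma convex_normal_cone: "convex (normal_cone C x)"
proof (cases "x \<in> C")
  case True
  then have "normal_cone C x = (\<Inter>y\<in>C. {v. (y - x) \<bullet> v \<le> 0})" by (auto simp: normal_cone_def inner_commute)
  then show ?thesis by (simp add: convex_INT convex_halfspace_le)
qed (simp add: normal_cone_def)

text \<open>
  The difficult inclusion is that of \<open>A x\<close> in the sum. If \<open>v \<in> A x\<close> were outside this closed
  convex set, a separating functional \<open>-a\<close> would be larger at \<open>v\<close> than on the sum and nonpositive on the
  normal cone. After a push of size \<open>\<epsilon>\<close> towards an interior point \<open>p\<close> it points into the domain,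
  so some \<open>w \<in> A0 A x\<close> is at least as large as \<open>v\<close> in the pushed direction. Monotonicity against a
  value at \<open>p\<close> bounds \<open>w \<bullet> (p - x)\<close> independently of \<open>w\<close>; so for small \<open>\<epsilon>\<close> the push is too weak to
  make up for the separation gap.
\<close>

theorem maximal_monotone_representation:
  fixes A :: "real^'n \<Rightarrow> (real^'n) set"
  assumes maxi: "maximal_monotone_op A" and int: "interior (dom_op A) \<noteq> {}"
  shows "A x = clco (A0 A x) + normal_cone (closure (dom_op A)) x"
proof
  let ?N = "normal_cone (closure (dom_op A)) x"
  let ?S = "clco (A0 A x) + ?N"
  show "?S \<subseteq> A x"
    using clco_A0_subset[OF maxi, of x] add_normal_cone_mem[OF maxi, of _ x] by (fastforce simp: set_plus_def)
  show "A x \<subseteq> ?S"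
  proof (rule subsetI, rule ccontr)
    fix v assume v: "v \<in> A x" and "v \<notin> ?S"
    have x: "x \<in> closure (dom_op A)" using v closure_subset by (force simp: dom_op_def)
    then have N0: "0 \<in> ?N" by (simp add: normal_cone_def)
    have A0S: "w \<in> clco (A0 A x)" if "w \<in> A0 A x" for w
      unfolding clco_def by (meson closure_subset hull_inc subsetD that)
    obtain p where p: "p \<in> interior (dom_op A)" using int by auto
    then obtain vp where vp: "vp \<in> A p" using interior_subset by (fastforce simp: dom_op_def)
    have "convex ?S" by (intro convex_set_plus convex_normal_cone) (simp add: clco_def convex_closure)
    then obtain a b where ab: "a \<bullet> v < b" "\<And>y. y \<in> ?S \<Longrightarrow> b < a \<bullet> y"
      using separating_hyperplane_closed_point closed_clco_A0_plus_normal_cone[OF maxi int] \<open>v \<notin> ?S\<close> by metis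
    have approx: "\<exists>w\<in>A0 A x. v \<bullet> (u + \<epsilon> *\<^sub>R (p - x)) \<le> w \<bullet> (u + \<epsilon> *\<^sub>R (p - x))"
      if "\<And>n. n \<in> ?N \<Longrightarrow> n \<bullet> u \<le> 0" "\<epsilon> > 0" for u \<epsilon>
      using ray_enters_interior_dom[OF maxi p x that] A0_directional_lower_bound[OF maxi v] by metis
    obtain w0 where w0: "w0 \<in> A0 A x" using approx[of 0 1] by auto
    have polar: "n \<bullet> (- a) \<le> 0" if n: "n \<in> ?N" for n
    proof (rule ccontr)
      assume "\<not> n \<bullet> (- a) \<le> 0"
      then have neg: "a \<bullet> n < 0" by (simp add: inner_commute)
      \<comment> \<open>Large enough for \<open>a\<close> to take a value at most \<open>b\<close> at \<open>w0 + \<tau> n\<close>.\<close>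
      define \<tau> where "\<tau> = (\<bar>b\<bar> + \<bar>a \<bullet> w0\<bar>) / - (a \<bullet> n)"
      have "\<tau> \<ge> 0" using neg unfolding \<tau>_def by (intro divide_nonneg_pos) auto
      then have "\<tau> *\<^sub>R n \<in> ?N" using n x by (auto simp: normal_cone_def mult_nonneg_nonpos)
      then have "b < a \<bullet> (w0 + \<tau> *\<^sub>R n)" using A0S[OF w0] by (intro ab(2) set_plus_intro)
      moreover have "\<tau> * (a \<bullet> n) = - (\<bar>b\<bar> + \<bar>a \<bullet> w0\<bar>)" using neg by (simp add: \<tau>_def)
      ultimately show False by (simp add: inner_add_right)
    qed
    define \<kappa> where "\<kappa> = \<bar>(vp - v) \<bullet> (p - x)\<bar> + 1"
    \<comment> \<open>The separation gap divided by a bound for the contribution of the push.\<close>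
    define \<epsilon> where "\<epsilon> = (b - a \<bullet> v) / \<kappa>"
    have \<kappa>: "\<kappa> > 0" "(vp - v) \<bullet> (p - x) \<le> \<kappa>" by (auto simp: \<kappa>_def)
    have \<epsilon>: "\<epsilon> > 0" using ab(1) \<kappa>(1) by (simp add: \<epsilon>_def)
    obtain w where w: "w \<in> A0 A x" "v \<bullet> (- a + \<epsilon> *\<^sub>R (p - x)) \<le> w \<bullet> (- a + \<epsilon> *\<^sub>R (p - x))"
      using approx[OF polar \<epsilon>] by blast
    have "w + 0 \<in> ?S" using A0S[OF w(1)] N0 by (rule set_plus_intro)
    then have "b < a \<bullet> w" using ab(2) by simp
    have "w \<in> A x" using w(1) A0_subset[OF maxi] by blast
    then have "0 \<le> (vp - w) \<bullet> (p - x)" using vp maximal_monotone_mem_iff[OF maxi] by blast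
    then have "w \<bullet> (p - x) - v \<bullet> (p - x) \<le> \<kappa>" using \<kappa>(2) by (simp add: inner_diff_left)
    then have "\<epsilon> * (w \<bullet> (p - x) - v \<bullet> (p - x)) \<le> \<epsilon> * \<kappa>" using \<epsilon> by simp
    also have "\<dots> = b - a \<bullet> v" using \<kappa>(1) by (simp add: \<epsilon>_def)
    finally have "a \<bullet> w \<le> b"
      using w(2) by (simp add: inner_add_right algebra_simps inner_commute[of _ a])
    then show False using \<open>b < a \<bullet> w\<close> by simp
  qed
qed

section \<open>Closedness of the equilibrium set\<close>

lemma equilibria_eq:
  fixes A :: "real^'n \<Rightarrow> (real^'n) set"
  assumes "maximal_monotone_op A" "interior (dom_op A) \<noteq> {}"
  shows "equilibria A f = {x \<in> closure (dom_op A). f x \<in> A x}"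
  using maximal_monotone_representation[OF assms] by (simp add: equilibria_def Let_def)

lemma locally_lipschitz_imp_continuous_on:
  assumes "locally_lipschitz_on C f"
  shows "continuous_on C f"
  unfolding continuous_on_eq_continuous_within
proof
  fix x assume x: "x \<in> C"
  then obtain r L where r: "r > 0" "L-lipschitz_on (ball x r \<inter> C) f"
    using assms unfolding locally_lipschitz_on_def by blast
  then have "continuous_on (C \<inter> ball x r) f"
    using lipschitz_on_continuous_on by (simp add: Int_commute)
  then have "continuous (at x within C \<inter> ball x r) f"
    using x r(1) by (simp add: continuous_on_eq_continuous_within)
  moreover have "at x within C \<inter> ball x r = at x within C"
    using r(1) by (intro at_within_nhd[of x "ball x r"]) auto
  ultimately show "continuous (at x within C) f" by (simp add: continuous_within)
qed

text \<open>
  The limit of equilibria is an equilibrium because \<open>f\<close> is continuous and the graph of \<open>A\<close> is closed.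
  The representation of \<open>A\<close> is needed here: at a boundary point, a limit of the sets
  \<open>clco (A0 A x)\<close> alone need not be controlled, as these sets can be unbounded nearby.
\<close>

lemma closed_equilibria:
  fixes A :: "real^'n \<Rightarrow> (real^'n) set"
  assumes maxi: "maximal_monotone_op A" and int: "interior (dom_op A) \<noteq> {}"
    and lip: "locally_lipschitz_on (closure (dom_op A)) f"
  shows "closed (equilibria A f)"
  unfolding closed_sequential_limits
proof (intro allI impI, elim conjE)
  fix e z assume e: "\<forall>k. e k \<in> equilibria A f" and ez: "e \<longlonglongrightarrow> z"
  then have e': "e k \<in> closure (dom_op A)" "f (e k) \<in> A (e k)" for k
    by (auto simp: equilibria_eq[OF maxi int])
  have z: "z \<in> closure (dom_op A)" using closed_sequentially[OF closed_closure e'(1) ez] .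
  have "(\<lambda>k. f (e k)) \<longlonglongrightarrow> f z"
    using locally_lipschitz_imp_continuous_on[OF lip] z e'(1) ez
    by (auto simp: continuous_on_sequentially o_def)
  then have "f z \<in> A z" using maximal_monotone_closed_graph[OF maxi ez _ e'(2)] by blast
  then show "z \<in> equilibria A f" using z by (simp add: equilibria_eq[OF maxi int])
qed

section \<open>Solutions of the differential inclusion\<close>

lemma absolutely_continuous_on_imp_continuous_on:
  assumes "absolutely_continuous_on a b x"
  shows "continuous_on {a..b} x"
  unfolding continuous_on_iff
proof (intro ballI allI impI)
  fix s \<epsilon> :: real assume s: "s \<in> {a..b}" and "\<epsilon> > 0"
  then obtain \<delta> where \<delta>: "\<delta> > 0" "\<And>(m::nat) u v.
        (\<forall>i<m. a \<le> u i \<and> u i \<le> v i \<and> v i \<le> b) \<and>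
        (\<forall>i<m. \<forall>j<m. i \<noteq> j \<longrightarrow> {u i<..<v i} \<inter> {u j<..<v j} = {}) \<and>
        (\<Sum>i<m. v i - u i) < \<delta> \<Longrightarrow> (\<Sum>i<m. norm (x (v i) - x (u i))) < \<epsilon>"
    using spec[OF assms[unfolded absolutely_continuous_on_def], THEN mp, of \<epsilon>] by blast
  have "dist (x t) (x s) < \<epsilon>" if t: "t \<in> {a..b}" "dist t s < \<delta>" for t
  proof (cases "s \<le> t")
    case True
    then show ?thesis
      using \<delta>(2)[of 1 "\<lambda>_. s" "\<lambda>_. t"] s t by (auto simp: dist_norm)
  next
    case False
    then show ?thesis
      using \<delta>(2)[of 1 "\<lambda>_. t" "\<lambda>_. s"] s t by (auto simp: dist_norm norm_minus_commute)
  qed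
  then show "\<exists>d>0. \<forall>t\<in>{a..b}. dist t s < d \<longrightarrow> dist (x t) (x s) < \<epsilon>" using \<delta>(1) by blast
qed

text \<open>
  The velocity condition gives \<open>x t \<in> dom_op A\<close> only for almost every \<open>t\<close>. By continuity, an excursion
  outside the closure would last for an open interval of times, which is not a null set.
\<close>

lemma solution_in_closure_dom:
  assumes sol: "solves_DI A f x0 x" and t: "t \<ge> 0"
  shows "x t \<in> closure (dom_op A)"
proof (rule ccontr)
  assume out: "x t \<notin> closure (dom_op A)"
  have "absolutely_continuous_on 0 (t + 1) x" using sol t by (simp add: solves_DI_def)
  then have "continuous_on {0..t+1} x" by (rule absolutely_continuous_on_imp_continuous_on)
  moreover have "open (- closure (dom_op A))" by auto
  moreover have "t \<in> {0..t+1}" "x t \<in> - closure (dom_op A)" using t out by auto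
  ultimately obtain U where U: "open U" "t \<in> U" "\<And>s. s \<in> {0..t+1} \<Longrightarrow> s \<in> U \<Longrightarrow> x s \<notin> closure (dom_op A)"
    unfolding continuous_on_topological by (metis ComplD)
  then obtain e where e: "e > 0" "ball t e \<subseteq> U" by (meson open_contains_ball)
  define h where "h = min e 1"
  have h: "h > 0" "h \<le> e" "h \<le> 1" using e by (auto simp: h_def)
  have sub: "x s \<notin> closure (dom_op A)" if "s \<in> {t<..<t+h}" for s
    using that h e(2) t by (intro U(3)) (auto simp: dist_real_def subset_iff)
  have "AE s in lebesgue. s \<notin> {t<..<t+h}"
  proof -
    have "AE s in lebesgue. s \<ge> 0 \<longrightarrow> (\<exists>a\<in>A (x s). (x has_vector_derivative (f (x s) - a)) (at s within {0..}))"
      using sol by (simp add: solves_DI_def)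
    then show ?thesis
    proof (rule AE_mp, intro AE_I2 impI notI)
      fix s assume s: "s \<in> {t<..<t+h}"
        and "s \<ge> 0 \<longrightarrow> (\<exists>a\<in>A (x s). (x has_vector_derivative (f (x s) - a)) (at s within {0..}))"
      then have "x s \<in> dom_op A" using t by (auto simp: dom_op_def)
      then show False using sub[OF s] closure_subset by blast
    qed
  qed
  then have "negligible {t<..<t+h}"
    by (simp add: AE_iff_null_sets negligible_iff_null_sets)
  then show False using h(1) open_not_negligible[of "{t<..<t+h}"] by auto
qed

lemma absolutely_continuous_on_shift:
  assumes ac: "absolutely_continuous_on a' b' x" and bounds: "a' \<le> a + c" "b + c \<le> b'"
  shows "absolutely_continuous_on a b (\<lambda>t. x (t + c))"
  unfolding absolutely_continuous_on_def
proof (intro allI impI)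
  fix \<epsilon> :: real assume "\<epsilon> > 0"
  then obtain \<delta> where \<delta>: "\<delta> > 0" "\<And>(m::nat) u v.
        (\<forall>i<m. a' \<le> u i \<and> u i \<le> v i \<and> v i \<le> b') \<and>
        (\<forall>i<m. \<forall>j<m. i \<noteq> j \<longrightarrow> {u i<..<v i} \<inter> {u j<..<v j} = {}) \<and>
        (\<Sum>i<m. v i - u i) < \<delta> \<Longrightarrow> (\<Sum>i<m. norm (x (v i) - x (u i))) < \<epsilon>"
    using spec[OF ac[unfolded absolutely_continuous_on_def], THEN mp, of \<epsilon>] by blast
  have "(\<Sum>i<m. norm (x (v i + c) - x (u i + c))) < \<epsilon>"
    if "\<forall>i<m. a \<le> u i \<and> u i \<le> v i \<and> v i \<le> b"
      "\<forall>i<m. \<forall>j<m. i \<noteq> j \<longrightarrow> {u i<..<v i} \<inter> {u j<..<v j} = {}"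
      "(\<Sum>i<m. v i - u i) < \<delta>" for m :: nat and u v
  proof -
    have "\<forall>i<m. \<forall>j<m. i \<noteq> j \<longrightarrow> {u i + c<..<v i + c} \<inter> {u j + c<..<v j + c} = {}"
    proof (intro allI impI)
      fix i j assume "i < m" "j < m" "i \<noteq> j"
      then have disj: "{u i<..<v i} \<inter> {u j<..<v j} = {}" using that(2) by blast
      have False if "s \<in> {u i + c<..<v i + c} \<inter> {u j + c<..<v j + c}" for s
      proof -
        have "s - c \<in> {u i<..<v i} \<inter> {u j<..<v j}" using that by auto
        then show False using disj by blast
      qed
      then show "{u i + c<..<v i + c} \<inter> {u j + c<..<v j + c} = {}" by blast
    qed
    moreover have "\<forall>i<m. a' \<le> u i + c \<and> u i + c \<le> v i + c \<and> v i + c \<le> b'"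
      using that(1) bounds by force
    ultimately show ?thesis using that(3) by (intro \<delta>(2)) auto
  qed
  then show "\<exists>\<delta>>0. \<forall>(m::nat) u v.
        (\<forall>i<m. a \<le> u i \<and> u i \<le> v i \<and> v i \<le> b) \<and>
        (\<forall>i<m. \<forall>j<m. i \<noteq> j \<longrightarrow> {u i<..<v i} \<inter> {u j<..<v j} = {}) \<and>
        (\<Sum>i<m. v i - u i) < \<delta> \<longrightarrow> (\<Sum>i<m. norm (x (v i + c) - x (u i + c))) < \<epsilon>"
    using \<delta>(1) by blast
qed

text \<open>
  The problem is autonomous; this lets Lyapunov stability be applied to the trajectory restarted at
  a late time.
\<close>

lemma solves_DI_shift:
  assumes sol: "solves_DI A f x0 x" and c: "c \<ge> 0"
  shows "solves_DI A f (x c) (\<lambda>t. x (t + c))"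
  unfolding solves_DI_def
proof (intro conjI allI impI)
  show "x (0 + c) = x c" by simp
  show "absolutely_continuous_on 0 T (\<lambda>t. x (t + c))" if "T \<ge> 0" for T
  proof (rule absolutely_continuous_on_shift)
    show "absolutely_continuous_on 0 (T + c) x" using sol that c by (simp add: solves_DI_def)
  qed (use c in auto)
  let ?P = "\<lambda>t. \<exists>a\<in>A (x t). (x has_vector_derivative (f (x t) - a)) (at t within {0..})"
  have "AE t in lebesgue. t \<ge> 0 \<longrightarrow> ?P t" using sol by (simp add: solves_DI_def)
  then have "negligible {t. \<not> (t \<ge> 0 \<longrightarrow> ?P t)}"
    by (simp add: completion.AE_iff_null_sets AE_iff_null_sets negligible_iff_null_sets)
  then have "negligible ((+) (- c) ` {t. \<not> (t \<ge> 0 \<longrightarrow> ?P t)})" by (rule negligible_translation)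
  moreover have "{t. \<not> (t + c \<ge> 0 \<longrightarrow> ?P (t + c))} \<subseteq> (+) (- c) ` {t. \<not> (t \<ge> 0 \<longrightarrow> ?P t)}"
    by (auto simp: image_iff intro!: exI[of _ "_ + c"])
  ultimately have "negligible {t. \<not> (t + c \<ge> 0 \<longrightarrow> ?P (t + c))}" by (rule negligible_subset)
  then have "AE t in lebesgue. t + c \<ge> 0 \<longrightarrow> ?P (t + c)"
    by (auto simp: negligible_iff_null_sets intro: AE_I')
  then show "AE t in lebesgue. t \<ge> 0 \<longrightarrow> (\<exists>a\<in>A (x (t + c)).
      ((\<lambda>t. x (t + c)) has_vector_derivative (f (x (t + c)) - a)) (at t within {0..}))"
  proof (rule AE_mp, intro AE_I2 impI)
    fix t assume t: "t \<ge> 0" and "t + c \<ge> 0 \<longrightarrow> ?P (t + c)"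
    then obtain a where a: "a \<in> A (x (t + c))"
      "(x has_vector_derivative (f (x (t + c)) - a)) (at (t + c) within {0..})" using c by auto
    have sub: "(\<lambda>t. t + c) ` {0..} \<subseteq> {0..}" using c by auto
    have "((\<lambda>t. t + c) has_vector_derivative 1) (at t within {0..})"
      by (auto intro!: derivative_eq_intros)
    then have "(x \<circ> (\<lambda>t. t + c) has_vector_derivative 1 *\<^sub>R (f (x (t + c)) - a)) (at t within {0..})"
      using has_vector_derivative_within_subset[OF a(2) sub] by (intro vector_diff_chain_within) auto
    then show "\<exists>a\<in>A (x (t + c)).
      ((\<lambda>t. x (t + c)) has_vector_derivative (f (x (t + c)) - a)) (at t within {0..})"
      using a(1) by (auto simp: o_def)
  qed
qed

section \<open>Convergence of the trajectory\<close>

theorem proposition3p3: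
  fixes A :: "real^'n \<Rightarrow> (real^'n) set"
    and f :: "real^'n \<Rightarrow> real^'n"
    and x0 :: "real^'n"
    and x :: "real \<Rightarrow> real^'n"
  assumes "maximal_monotone_op A"
    and "interior (dom_op A) \<noteq> {}"
    and "locally_lipschitz_on (closure (dom_op A)) f"
    and wellposed: "\<And>y0. y0 \<in> closure (dom_op A) \<Longrightarrow>
          \<exists>y. solves_DI A f y0 y \<and> (\<forall>y'. solves_DI A f y0 y' \<longrightarrow> (\<forall>t\<ge>0. y' t = y t))"
    and "\<And>xbar. xbar \<in> equilibria A f \<Longrightarrow> lyapunov_stable A f xbar"
    and "x0 \<in> closure (dom_op A)"
    and "solves_DI A f x0 x"
    and "bounded (x ` {0..})"
    and "((\<lambda>t. dist_set (x t) (equilibria A f)) \<longlongrightarrow> 0) at_top"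
  shows "\<exists>z \<in> equilibria A f. (x \<longlongrightarrow> z) at_top"
proof -
  let ?E = "equilibria A f"
  have E: "?E \<noteq> {}"
  proof
    assume "?E = {}"
    then have "((\<lambda>t::real. \<infinity> :: ereal) \<longlongrightarrow> 0) at_top" using assms(9) by (simp add: dist_set_empty)
    then show False by (simp add: tendsto_const_iff)
  qed
  have dist0: "((\<lambda>t. infdist (x t) ?E) \<longlongrightarrow> 0) at_top"
    using assms(9) E by (simp add: dist_set_nonempty zero_ereal_def)
  have "bounded (range (\<lambda>k::nat. x (real k)))" by (rule bounded_subset[OF assms(8)]) auto
  then obtain z \<sigma> where \<sigma>: "strict_mono \<sigma>" "((\<lambda>k. x (real k)) \<circ> \<sigma>) \<longlonglongrightarrow> z"
    using bounded_imp_convergent_subsequence by blast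
  have time: "filterlim (\<lambda>k. real (\<sigma> k)) at_top sequentially"
    using filterlim_compose[OF filterlim_real_sequentially filterlim_subseq[OF \<sigma>(1)]] .
  have "(\<lambda>k. infdist (x (real (\<sigma> k))) ?E) \<longlonglongrightarrow> 0" using filterlim_compose[OF dist0 time] .
  moreover have "(\<lambda>k. infdist (x (real (\<sigma> k))) ?E) \<longlonglongrightarrow> infdist z ?E"
    using \<sigma>(2) by (intro tendsto_infdist) (simp add: o_def)
  ultimately have "infdist z ?E = 0" by (rule LIMSEQ_unique[rotated])
  then have z: "z \<in> ?E"
    using in_closed_iff_infdist_zero[OF closed_equilibria[OF assms(1-3)] E] by simp
  have "(x \<longlongrightarrow> z) at_top"
    unfolding tendsto_iff
  proof (intro allI impI)
    fix \<epsilon> :: real assume "\<epsilon> > 0"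
    then obtain \<delta> where \<delta>: "\<delta> > 0" "\<And>y0 y t. y0 \<in> closure (dom_op A) \<Longrightarrow> norm (y0 - z) \<le> \<delta> \<Longrightarrow>
        solves_DI A f y0 y \<Longrightarrow> t \<ge> 0 \<Longrightarrow> norm (y t - z) < \<epsilon>"
      using assms(5)[OF z] unfolding lyapunov_stable_def by metis
    obtain k where k: "dist (x (real (\<sigma> k))) z < \<delta>"
      using \<sigma>(2) \<delta>(1) unfolding lim_sequentially by fastforce
    have "dist (x t) z < \<epsilon>" if "t \<ge> real (\<sigma> k)" for t
      using \<delta>(2)[OF solution_in_closure_dom[OF assms(7)] _ solves_DI_shift[OF assms(7)],
          of "real (\<sigma> k)" "t - real (\<sigma> k)"] k that by (simp add: dist_norm)
    then show "\<forall>\<^sub>F t in at_top. dist (x t) z < \<epsilon>"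
      unfolding eventually_at_top_linorder by blast
  qed
  then show ?thesis using z by blast
qed

end
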